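(* For every purely existential $\mathcal{L}^-_{BT}$-sentence $\phi$: if $\mathfrak{B}^-\models\phi$, then $B^-\vdash\phi$.
   Context: Bit strings are elements of $\{\mathbf{0},\mathbf{1}\}^*$; $\varepsilon$ is the empty string. The language $\mathcal{L}^-_{BT}$ has constant symbols $e,0,1$ and a binary function symbol $\circ$ (also written as juxtaposition). The structure $\mathfrak{B}^-$ has universe $\{\mathbf{0},\mathbf{1}\}^*$ and interprets $e,0,1$ as $\varepsilon,\mathbf{0},\mathbf{1}$ and $\circ$ as concatenation. A purely existential $\mathcal{L}^-_{BT}$-formula is one built from equations $s=t$ and negated equations $\neg s=t$ (terms $s,t$) using $\wedge$, $\vee$ and unbounded existential quantifiers $\exists x$. The theory $B^-$ has the four axioms: (1) $\forall x[x=ex\wedge x=xe]$; (2) $\forall xyz[(xy)z=x(yz)]$; (3) $\forall xy[x\neq y\to(x0\neq y0\wedge x1\neq y1)]$; (4) $\forall xy[x0\neq y1]$. *)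

theory Defs
  imports Main
begin

datatype trm =
    Var nat  \<comment> \<open>de Bruijn index\<close>
  | E
  | Zero
  | One
  | Conc trm trm  (infixl \<open>\<cdot>\<close> 70)

datatype fm =
    Eq trm trm  (infix \<open>\<doteq>\<close> 60)
  | Neg fm
  | And fm fm
  | Or fm fm
  | Imp fm fm
  | All fm
  | Ex fm

primrec fv_trm :: "trm \<Rightarrow> nat set" where
  "fv_trm (Var n) = {n}"
| "fv_trm E = {}"
| "fv_trm Zero = {}"
| "fv_trm One = {}"
| "fv_trm (s \<cdot> t) = fv_trm s \<union> fv_trm t"

primrec fv :: "fm \<Rightarrow> nat set" where
  "fv (s \<doteq> t) = fv_trm s \<union> fv_trm t"
| "fv (Neg p) = fv p"
| "fv (And p q) = fv p \<union> fv q"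
| "fv (Or p q) = fv p \<union> fv q"
| "fv (Imp p q) = fv p \<union> fv q"
| "fv (All p) = {n. Suc n \<in> fv p}"
| "fv (Ex p) = {n. Suc n \<in> fv p}"

definition sentence :: "fm \<Rightarrow> bool" where
  "sentence p \<longleftrightarrow> fv p = {}"

inductive purely_existential :: "fm \<Rightarrow> bool" where
  "purely_existential (s \<doteq> t)"
| "purely_existential (Neg (s \<doteq> t))"
| "purely_existential p \<Longrightarrow> purely_existential q \<Longrightarrow> purely_existential (And p q)"
| "purely_existential p \<Longrightarrow> purely_existential q \<Longrightarrow> purely_existential (Or p q)"
| "purely_existential p \<Longrightarrow> purely_existential (Ex p)"

text \<open>The universe of a structure is the whole type \<^typ>\<open>'a\<close>.\<close>

record 'a str =
  e_of :: 'a
  zero_of :: 'a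
  one_of :: 'a
  conc_of :: "'a \<Rightarrow> 'a \<Rightarrow> 'a"

primrec val :: "'a str \<Rightarrow> (nat \<Rightarrow> 'a) \<Rightarrow> trm \<Rightarrow> 'a" where
  "val M \<rho> (Var n) = \<rho> n"
| "val M \<rho> E = e_of M"
| "val M \<rho> Zero = zero_of M"
| "val M \<rho> One = one_of M"
| "val M \<rho> (s \<cdot> t) = conc_of M (val M \<rho> s) (val M \<rho> t)"

primrec sat :: "'a str \<Rightarrow> (nat \<Rightarrow> 'a) \<Rightarrow> fm \<Rightarrow> bool" where
  "sat M \<rho> (s \<doteq> t) \<longleftrightarrow> val M \<rho> s = val M \<rho> t"
| "sat M \<rho> (Neg p) \<longleftrightarrow> \<not> sat M \<rho> p"
| "sat M \<rho> (And p q) \<longleftrightarrow> sat M \<rho> p \<and> sat M \<rho> q"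
| "sat M \<rho> (Or p q) \<longleftrightarrow> sat M \<rho> p \<or> sat M \<rho> q"
| "sat M \<rho> (Imp p q) \<longleftrightarrow> (sat M \<rho> p \<longrightarrow> sat M \<rho> q)"
| "sat M \<rho> (All p) \<longleftrightarrow> (\<forall>a. sat M (case_nat a \<rho>) p)"
| "sat M \<rho> (Ex p) \<longleftrightarrow> (\<exists>a. sat M (case_nat a \<rho>) p)"

definition models :: "'a str \<Rightarrow> fm \<Rightarrow> bool"  (infix \<open>\<Turnstile>\<close> 50) where
  "M \<Turnstile> p \<longleftrightarrow> (\<forall>\<rho>. sat M \<rho> p)"

text \<open>Bit strings are Boolean lists, with \<^const>\<open>False\<close> and \<^const>\<open>True\<close> as the bits 0 and 1.\<close>

definition B_str :: "bool list str" where
  "B_str = \<lparr>e_of = [], zero_of = [False], one_of = [True], conc_of = (@)\<rparr>"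

primrec subst_trm :: "(nat \<Rightarrow> trm) \<Rightarrow> trm \<Rightarrow> trm" where
  "subst_trm \<sigma> (Var n) = \<sigma> n"
| "subst_trm \<sigma> E = E"
| "subst_trm \<sigma> Zero = Zero"
| "subst_trm \<sigma> One = One"
| "subst_trm \<sigma> (s \<cdot> t) = subst_trm \<sigma> s \<cdot> subst_trm \<sigma> t"

abbreviation lift_trm :: "trm \<Rightarrow> trm" where
  "lift_trm \<equiv> subst_trm (\<lambda>n. Var (Suc n))"

text \<open>Parallel, capture-avoiding substitution: \<open>\<sigma>\<close> is adjusted when passing under a binder.\<close>

primrec subst :: "(nat \<Rightarrow> trm) \<Rightarrow> fm \<Rightarrow> fm" where
  "subst \<sigma> (s \<doteq> t) = (subst_trm \<sigma> s \<doteq> subst_trm \<sigma> t)"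
| "subst \<sigma> (Neg p) = Neg (subst \<sigma> p)"
| "subst \<sigma> (And p q) = And (subst \<sigma> p) (subst \<sigma> q)"
| "subst \<sigma> (Or p q) = Or (subst \<sigma> p) (subst \<sigma> q)"
| "subst \<sigma> (Imp p q) = Imp (subst \<sigma> p) (subst \<sigma> q)"
| "subst \<sigma> (All p) = All (subst (case_nat (Var 0) (\<lambda>n. lift_trm (\<sigma> n))) p)"
| "subst \<sigma> (Ex p) = Ex (subst (case_nat (Var 0) (\<lambda>n. lift_trm (\<sigma> n))) p)"

abbreviation lift :: "fm \<Rightarrow> fm" where
  "lift \<equiv> subst (\<lambda>n. Var (Suc n))"

text \<open>\<open>inst t p\<close> instantiates the outermost bound variable (index 0) of the body \<open>p\<close> by \<open>t\<close>.\<close>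

abbreviation inst :: "trm \<Rightarrow> fm \<Rightarrow> fm" where
  "inst t \<equiv> subst (case_nat t Var)"

text \<open>
  In \<open>AllI\<close> and \<open>ExE\<close>, lifting the context (and the conclusion) makes index 0 fresh,
  which expresses the eigenvariable condition.
\<close>

inductive deriv :: "fm set \<Rightarrow> fm \<Rightarrow> bool"  (infix \<open>\<turnstile>\<close> 50) where
  Assm: "p \<in> \<Gamma> \<Longrightarrow> \<Gamma> \<turnstile> p"
| NegI: "insert p \<Gamma> \<turnstile> q \<Longrightarrow> insert p \<Gamma> \<turnstile> Neg q \<Longrightarrow> \<Gamma> \<turnstile> Neg p"
| Classical: "insert (Neg p) \<Gamma> \<turnstile> q \<Longrightarrow> insert (Neg p) \<Gamma> \<turnstile> Neg q \<Longrightarrow> \<Gamma> \<turnstile> p"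
| AndI: "\<Gamma> \<turnstile> p \<Longrightarrow> \<Gamma> \<turnstile> q \<Longrightarrow> \<Gamma> \<turnstile> And p q"
| AndE1: "\<Gamma> \<turnstile> And p q \<Longrightarrow> \<Gamma> \<turnstile> p"
| AndE2: "\<Gamma> \<turnstile> And p q \<Longrightarrow> \<Gamma> \<turnstile> q"
| OrI1: "\<Gamma> \<turnstile> p \<Longrightarrow> \<Gamma> \<turnstile> Or p q"
| OrI2: "\<Gamma> \<turnstile> q \<Longrightarrow> \<Gamma> \<turnstile> Or p q"
| OrE: "\<Gamma> \<turnstile> Or p q \<Longrightarrow> insert p \<Gamma> \<turnstile> r \<Longrightarrow> insert q \<Gamma> \<turnstile> r \<Longrightarrow> \<Gamma> \<turnstile> r"
| ImpI: "insert p \<Gamma> \<turnstile> q \<Longrightarrow> \<Gamma> \<turnstile> Imp p q"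
| ImpE: "\<Gamma> \<turnstile> Imp p q \<Longrightarrow> \<Gamma> \<turnstile> p \<Longrightarrow> \<Gamma> \<turnstile> q"
| AllI: "lift ` \<Gamma> \<turnstile> p \<Longrightarrow> \<Gamma> \<turnstile> All p"
| AllE: "\<Gamma> \<turnstile> All p \<Longrightarrow> \<Gamma> \<turnstile> inst t p"
| ExI: "\<Gamma> \<turnstile> inst t p \<Longrightarrow> \<Gamma> \<turnstile> Ex p"
| ExE: "\<Gamma> \<turnstile> Ex p \<Longrightarrow> insert p (lift ` \<Gamma>) \<turnstile> lift q \<Longrightarrow> \<Gamma> \<turnstile> q"
| EqI: "\<Gamma> \<turnstile> t \<doteq> t"
| EqE: "\<Gamma> \<turnstile> s \<doteq> t \<Longrightarrow> \<Gamma> \<turnstile> inst s p \<Longrightarrow> \<Gamma> \<turnstile> inst t p"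

definition B_minus :: "fm set" where
  "B_minus = {
     All (And (Var 0 \<doteq> E \<cdot> Var 0) (Var 0 \<doteq> Var 0 \<cdot> E)),
     All (All (All ((Var 2 \<cdot> Var 1) \<cdot> Var 0 \<doteq> Var 2 \<cdot> (Var 1 \<cdot> Var 0)))),
     All (All (Imp (Neg (Var 1 \<doteq> Var 0))
       (And (Neg (Var 1 \<cdot> Zero \<doteq> Var 0 \<cdot> Zero)) (Neg (Var 1 \<cdot> One \<doteq> Var 0 \<cdot> One))))),
     All (All (Neg (Var 1 \<cdot> Zero \<doteq> Var 0 \<cdot> One)))}"

end

(* A true purely existential sentence has witnesses in the standard model, so it suffices to replace
   them by numerals, i.e. canonical closed terms for bit strings. B^- proves every closed term equal to
   the numeral of its value. Distinct numerals are provably distinct by comparing last bits with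
   axioms (3) and (4), down to the comparison of e with some t0 or t1; e = t0 would give
   e1 = (e1)(t0) = ((e1)t)0, contradicting (4), and symmetrically for t1. *)
theory Submission
  imports Defs
begin

lemma subst_trm_comp: "subst_trm \<sigma> (subst_trm \<tau> t) = subst_trm (\<lambda>n. subst_trm \<sigma> (\<tau> n)) t"
  by (induction t) auto

lemma subst_trm_ident: "(\<And>n. n \<in> fv_trm t \<Longrightarrow> \<sigma> n = Var n) \<Longrightarrow> subst_trm \<sigma> t = t"
  by (induction t) auto

text \<open>A lifted term avoids index 0, so \<open>s\<close> cannot enter it. In the equality rules
  below, \<open>lift_trm\<close> thus protects the parts of a formula that an instantiation must
  leave alone.\<close>

lemma subst_trm_lift [simp]: "subst_trm (case_nat s \<sigma>) (lift_trm t) = subst_trm \<sigma> t"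
  by (simp add: subst_trm_comp)

lemma subst_trm_Var [simp]: "subst_trm Var t = t"
  by (simp add: subst_trm_ident)

text \<open>This is the quantifier case of composing substitutions: index 0 stays fixed, and on the
  other indices composing commutes with lifting.\<close>

lemma case_nat_lift_comp:
  "(\<lambda>n. subst_trm (case_nat (Var 0) (\<lambda>n. lift_trm (\<sigma> n))) (case_nat (Var 0) (\<lambda>n. lift_trm (\<tau> n)) n)) =
   case_nat (Var 0) (\<lambda>n. lift_trm (subst_trm \<sigma> (\<tau> n)))"
  by (rule ext) (auto simp: subst_trm_comp split: nat.split)

lemma subst_comp: "subst \<sigma> (subst \<tau> p) = subst (\<lambda>n. subst_trm \<sigma> (\<tau> n)) p"
  by (induction p arbitrary: \<sigma> \<tau>) (simp_all add: subst_trm_comp case_nat_lift_comp)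

lemma subst_ident: "(\<And>n. n \<in> fv p \<Longrightarrow> \<sigma> n = Var n) \<Longrightarrow> subst \<sigma> p = p"
proof (induction p arbitrary: \<sigma>)
  case (Eq s t)
  then show ?case by (simp add: subst_trm_ident)
next
  case (All p)
  \<comment> \<open>Under the binder, index 0 is fixed by construction, and \<open>Suc n\<close> is
    fixed because \<open>\<sigma>\<close> fixes \<open>n\<close>.\<close>
  then have "subst (case_nat (Var 0) (\<lambda>n. lift_trm (\<sigma> n))) p = p"
    by (intro All.IH) (auto split: nat.split)
  then show ?case by simp
next
  case (Ex p)
  then have "subst (case_nat (Var 0) (\<lambda>n. lift_trm (\<sigma> n))) p = p"
    by (intro Ex.IH) (auto split: nat.split)
  then show ?case by simp
qed auto

text \<open>Identifies the premise that \<open>ExI\<close> requires with a substitution whose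
  assignment is extended by the witness.\<close>

lemma inst_subst_lifted:
  "inst t (subst (case_nat (Var 0) (\<lambda>n. lift_trm (\<sigma> n))) p) = subst (case_nat t \<sigma>) p"
proof -
  have "(\<lambda>n. subst_trm (case_nat t Var) (case_nat (Var 0) (\<lambda>n. lift_trm (\<sigma> n)) n)) = case_nat t \<sigma>"
    by (rule ext) (auto split: nat.split)
  then show ?thesis by (simp add: subst_comp)
qed

lemma Eq_sym: "\<Gamma> \<turnstile> s \<doteq> t \<Longrightarrow> \<Gamma> \<turnstile> t \<doteq> s"
  \<comment> \<open>Leibniz rule: \<open>Var 0\<close> marks the occurrence to be rewritten, and the
    premise \<open>inst s\<close> is reflexivity.\<close>
  using EqE[of \<Gamma> s t "Var 0 \<doteq> lift_trm s"] by (simp add: EqI)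

lemma Eq_trans: "\<Gamma> \<turnstile> s \<doteq> t \<Longrightarrow> \<Gamma> \<turnstile> t \<doteq> u \<Longrightarrow> \<Gamma> \<turnstile> s \<doteq> u"
  using EqE[of \<Gamma> t u "lift_trm s \<doteq> Var 0"] by simp

lemma Eq_Conc:
  assumes "\<Gamma> \<turnstile> s \<doteq> s'" and "\<Gamma> \<turnstile> t \<doteq> t'"
  shows "\<Gamma> \<turnstile> s \<cdot> t \<doteq> s' \<cdot> t'"
proof -
  have "\<Gamma> \<turnstile> s \<cdot> t \<doteq> s' \<cdot> t"
    using EqE[OF assms(1), of "lift_trm (s \<cdot> t) \<doteq> Var 0 \<cdot> lift_trm t"] by (simp add: EqI)
  moreover have "\<Gamma> \<turnstile> s' \<cdot> t \<doteq> s' \<cdot> t'"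
    using EqE[OF assms(2), of "lift_trm (s' \<cdot> t) \<doteq> lift_trm s' \<cdot> Var 0"] by (simp add: EqI)
  ultimately show ?thesis by (rule Eq_trans)
qed

text \<open>Inclusion of contexts survives both inserting a hypothesis and lifting, the only changes
  that rules make. It carries theorems of \<open>B_minus\<close> into refutations that assume an
  extra equation.\<close>

lemma weaken: "\<Gamma> \<turnstile> p \<Longrightarrow> \<Gamma> \<subseteq> \<Delta> \<Longrightarrow> \<Delta> \<turnstile> p"
proof (induction arbitrary: \<Delta> rule: deriv.induct)
  case (NegI p \<Gamma> q)
  then show ?case by (meson deriv.NegI insert_mono)
next
  case (Classical p \<Gamma> q)
  then show ?case by (meson deriv.Classical insert_mono)
next
  case (OrE \<Gamma> p q r)
  then show ?case by (meson deriv.OrE insert_mono)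
next
  case (ImpI p \<Gamma> q)
  then show ?case by (meson deriv.ImpI insert_mono)
next
  case (AllI \<Gamma> p)
  then show ?case by (intro deriv.AllI) (simp add: image_mono)
next
  case (ExE \<Gamma> p q)
  from ExE.prems have "insert p (lift ` \<Gamma>) \<subseteq> insert p (lift ` \<Delta>)"
    by (intro insert_mono image_mono)
  then show ?case by (rule deriv.ExE[OF ExE.IH(1)[OF ExE.prems] ExE.IH(2)])
qed (blast intro: deriv.intros)+

lemma Neg_if_refuted:
  assumes "\<Gamma> \<turnstile> Neg q" and "insert p \<Gamma> \<turnstile> q"
  shows "\<Gamma> \<turnstile> Neg p"
  using assms by (meson NegI weaken subset_insertI)

lemma Neg_Eq_cong:
  assumes "\<Gamma> \<turnstile> Neg (s \<doteq> t)" and "\<Gamma> \<turnstile> s \<doteq> s'" and "\<Gamma> \<turnstile> t \<doteq> t'"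
  shows "\<Gamma> \<turnstile> Neg (s' \<doteq> t')"
proof -
  have "insert (s' \<doteq> t') \<Gamma> \<turnstile> s \<doteq> t"
    using assms(2,3) by (meson Assm Eq_sym Eq_trans insertI1 subset_insertI weaken)
  with assms(1) show ?thesis by (rule Neg_if_refuted)
qed

lemma Neg_Eq_sym: "\<Gamma> \<turnstile> Neg (s \<doteq> t) \<Longrightarrow> \<Gamma> \<turnstile> Neg (t \<doteq> s)"
  by (meson Neg_if_refuted Assm Eq_sym insertI1)

lemma B_minus_E_Conc: "B_minus \<turnstile> E \<cdot> t \<doteq> t"
proof -
  have "B_minus \<turnstile> All (And (Var 0 \<doteq> E \<cdot> Var 0) (Var 0 \<doteq> Var 0 \<cdot> E))"
    by (rule Assm) (simp add: B_minus_def)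
  from AllE[OF this, of t] show ?thesis by (auto intro: Eq_sym dest: AndE1)
qed

lemma B_minus_Conc_E: "B_minus \<turnstile> t \<cdot> E \<doteq> t"
proof -
  have "B_minus \<turnstile> All (And (Var 0 \<doteq> E \<cdot> Var 0) (Var 0 \<doteq> Var 0 \<cdot> E))"
    by (rule Assm) (simp add: B_minus_def)
  from AllE[OF this, of t] show ?thesis by (auto intro: Eq_sym dest: AndE2)
qed

lemma B_minus_assoc: "B_minus \<turnstile> (s \<cdot> t) \<cdot> u \<doteq> s \<cdot> (t \<cdot> u)"
proof -
  have "B_minus \<turnstile> All (All (All ((Var 2 \<cdot> Var 1) \<cdot> Var 0 \<doteq> Var 2 \<cdot> (Var 1 \<cdot> Var 0))))"
    by (rule Assm) (simp add: B_minus_def)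
  \<comment> \<open>Each term put in for an outer quantifier is lifted past the inner ones; the
    later instantiations undo these lifts.\<close>
  from AllE[OF AllE[OF AllE[OF this, of s, simplified], of t, simplified], of u]
  show ?thesis by (simp add: numeral_2_eq_2 subst_trm_comp)
qed

definition bit :: "bool \<Rightarrow> trm" where
  "bit b = (if b then One else Zero)"

lemma subst_trm_bit [simp]: "subst_trm \<sigma> (bit b) = bit b"
  by (simp add: bit_def)

lemma B_minus_cancel:
  assumes "B_minus \<turnstile> Neg (s \<doteq> t)"
  shows "B_minus \<turnstile> Neg (s \<cdot> bit b \<doteq> t \<cdot> bit b)"
proof -
  have "B_minus \<turnstile> All (All (Imp (Neg (Var 1 \<doteq> Var 0))
       (And (Neg (Var 1 \<cdot> Zero \<doteq> Var 0 \<cdot> Zero)) (Neg (Var 1 \<cdot> One \<doteq> Var 0 \<cdot> One)))))"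
    by (rule Assm) (simp add: B_minus_def)
  from AllE[OF AllE[OF this, of s, simplified], of t]
  have "B_minus \<turnstile> Imp (Neg (s \<doteq> t))
      (And (Neg (s \<cdot> Zero \<doteq> t \<cdot> Zero)) (Neg (s \<cdot> One \<doteq> t \<cdot> One)))"
    by simp
  from ImpE[OF this assms] show ?thesis
    by (auto simp: bit_def dest: AndE1 AndE2)
qed

text \<open>Axiom (4) treats only 0 on the left and 1 on the right; symmetry of disequality gives
  the other order.\<close>

lemma B_minus_last_bit_neq:
  assumes "b \<noteq> c"
  shows "B_minus \<turnstile> Neg (s \<cdot> bit b \<doteq> t \<cdot> bit c)"
proof -
  have "B_minus \<turnstile> All (All (Neg (Var 1 \<cdot> Zero \<doteq> Var 0 \<cdot> One)))"
    by (rule Assm) (simp add: B_minus_def)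
  from AllE[OF AllE[OF this, simplified]]
  have "B_minus \<turnstile> Neg (u \<cdot> Zero \<doteq> v \<cdot> One)" for u v
    by fastforce
  with assms show ?thesis
    by (cases b) (auto simp: bit_def intro: Neg_Eq_sym)
qed

lemma B_minus_E_neq: "B_minus \<turnstile> Neg (E \<doteq> t \<cdot> bit b)"
proof -
  \<comment> \<open>The leading \<open>E\<close> gives \<open>?s\<close> the form of a product
    ending in a bit, which \<open>B_minus_last_bit_neq\<close> requires.\<close>
  let ?s = "E \<cdot> bit (\<not> b)"
  let ?\<Gamma> = "insert (E \<doteq> t \<cdot> bit b) B_minus"
  have "?\<Gamma> \<turnstile> ?s \<doteq> ?s \<cdot> E"
    by (meson B_minus_Conc_E Eq_sym subset_insertI weaken)
  moreover have "?\<Gamma> \<turnstile> ?s \<cdot> E \<doteq> ?s \<cdot> (t \<cdot> bit b)"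
    by (meson Assm EqI Eq_Conc insertI1)
  moreover have "?\<Gamma> \<turnstile> ?s \<cdot> (t \<cdot> bit b) \<doteq> (?s \<cdot> t) \<cdot> bit b"
    by (meson B_minus_assoc Eq_sym subset_insertI weaken)
  ultimately have "?\<Gamma> \<turnstile> ?s \<doteq> (?s \<cdot> t) \<cdot> bit b"
    by (meson Eq_trans)
  moreover have "B_minus \<turnstile> Neg (?s \<doteq> (?s \<cdot> t) \<cdot> bit b)"
    by (simp add: B_minus_last_bit_neq)
  ultimately show ?thesis by (metis Neg_if_refuted)
qed

text \<open>Nesting to the left puts the last bit outermost, where axioms (3) and (4) see
  it.\<close>

definition num :: "bool list \<Rightarrow> trm" where
  "num xs = foldl (\<lambda>t b. t \<cdot> bit b) E xs"

lemma num_Nil [simp]: "num [] = E"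
  and num_snoc [simp]: "num (xs @ [b]) = num xs \<cdot> bit b"
  by (simp_all add: num_def)

lemma B_minus_num_append: "B_minus \<turnstile> num xs \<cdot> num ys \<doteq> num (xs @ ys)"
proof (induction ys rule: rev_induct)
  case Nil
  show ?case by (simp add: B_minus_Conc_E)
next
  case (snoc b ys)
  \<comment> \<open>Associativity moves \<open>bit b\<close> outside, where the induction hypothesis
    rewrites the left factor.\<close>
  have "B_minus \<turnstile> num xs \<cdot> (num ys \<cdot> bit b) \<doteq> num (xs @ ys) \<cdot> bit b"
    by (meson B_minus_assoc Eq_sym Eq_trans Eq_Conc EqI snoc)
  then show ?case by (simp flip: append_assoc)
qed

lemma B_minus_num_neq: "xs \<noteq> ys \<Longrightarrow> B_minus \<turnstile> Neg (num xs \<doteq> num ys)"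
proof (induction xs arbitrary: ys rule: rev_induct)
  case Nil
  then show ?case by (cases ys rule: rev_cases) (auto intro: B_minus_E_neq)
next
  case (snoc b xs)
  show ?case
  proof (cases ys rule: rev_cases)
    case Nil
    then show ?thesis by (auto intro: Neg_Eq_sym B_minus_E_neq)
  next
    case (snoc ys' c)
    \<comment> \<open>If the last bits agree, the prefixes differ, and the induction hypothesis
      applies to them.\<close>
    then show ?thesis
      using snoc.IH[of ys'] snoc.prems
      by (cases "b = c") (auto intro: B_minus_cancel B_minus_last_bit_neq)
  qed
qed

lemma B_minus_num_val: "B_minus \<turnstile> subst_trm (\<lambda>n. num (\<rho> n)) t \<doteq> num (val B_str \<rho> t)"
proof (induction t)
  case Zero
  \<comment> \<open>The numeral of the string 0 is \<open>E \<cdot> Zero\<close>, so even a constant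
    needs axiom (1).\<close>
  show ?case
    using Eq_sym[OF B_minus_E_Conc[of Zero]] by (simp add: B_str_def num_def bit_def)
next
  case One
  show ?case
    using Eq_sym[OF B_minus_E_Conc[of One]] by (simp add: B_str_def num_def bit_def)
next
  case (Conc s t)
  then have "B_minus \<turnstile> subst_trm (\<lambda>n. num (\<rho> n)) (s \<cdot> t) \<doteq> num (val B_str \<rho> s @ val B_str \<rho> t)"
    by (auto intro: Eq_trans[OF Eq_Conc B_minus_num_append])
  then show ?case by (simp add: B_str_def)
qed (auto simp: B_str_def intro: EqI)

text \<open>Bodies of quantifiers are open, so the induction needs an arbitrary assignment, whose
  values enter the formula as numerals.\<close>

lemma B_minus_complete:
  "purely_existential p \<Longrightarrow> sat B_str \<rho> p \<Longrightarrow> B_minus \<turnstile> subst (\<lambda>n. num (\<rho> n)) p"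
proof (induction arbitrary: \<rho> rule: purely_existential.induct)
  case (1 s t)
  then show ?case
    by simp (metis B_minus_num_val Eq_sym Eq_trans)
next
  case (2 s t)
  then have "B_minus \<turnstile> Neg (num (val B_str \<rho> s) \<doteq> num (val B_str \<rho> t))"
    by (simp add: B_minus_num_neq)
  from Neg_Eq_cong[OF this Eq_sym[OF B_minus_num_val] Eq_sym[OF B_minus_num_val]]
  show ?case by simp
next
  case (5 p)
  then obtain xs where "sat B_str (case_nat xs \<rho>) p" by auto
  from "5.IH"[OF this] have "B_minus \<turnstile> subst (\<lambda>n. num (case_nat xs \<rho> n)) p" .
  moreover have "(\<lambda>n. num (case_nat xs \<rho> n)) = case_nat (num xs) (\<lambda>n. num (\<rho> n))"
    by (rule ext) (simp split: nat.split)
  ultimately have "B_minus \<turnstile> subst (case_nat (num xs) (\<lambda>n. num (\<rho> n))) p"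
    by simp
  then show ?case by (simp add: ExI inst_subst_lifted)
qed (auto intro: AndI OrI1 OrI2)

theorem theorem3:
  fixes \<phi> :: fm
  assumes "purely_existential \<phi>" and "sentence \<phi>" and "B_str \<Turnstile> \<phi>"
  shows "B_minus \<turnstile> \<phi>"
proof -
  \<comment> \<open>Any assignment would do; the constant empty string is chosen, and the
    substitution leaves a sentence unchanged.\<close>
  have "B_minus \<turnstile> subst (\<lambda>n. num []) \<phi>"
    using assms(1,3) by (intro B_minus_complete) (simp_all add: models_def)
  moreover have "subst (\<lambda>n. num []) \<phi> = \<phi>"
    using assms(2) by (intro subst_ident) (simp add: sentence_def)
  ultimately show ?thesis by simp
qed

end
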